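(* Let $R$ be a finite ring with identity, let $\mathcal{A}$ be a finite Frobenius $R$-$R$ bimodule, and let $\mathbf{w}$ be the homogeneous weight on $\mathcal{A}$ with average value $\gamma>0$, extended additively to $\mathcal{A}^n$. Let $\sigma,\lambda,\delta$ be real numbers with $0<\delta$ and $0\le\lambda<\sigma\le1$. Then $$\alpha(\mathcal A:\sigma,\lambda,\delta)\le\begin{cases}0&\text{if }\delta>\gamma\sigma,\\ \sigma-\dfrac{\delta}{\gamma}&\text{if }\delta\le\gamma\sigma.\end{cases}$$
   Context: For a finite ring $R$, $\hat R=\mathrm{Hom}_{\mathbb Z}(R,\mathbb C^\times)$ is an $R$-$R$ bimodule via $({}^{r}\phi)(x)=\phi(xr)$, $(\phi^{r})(x)=\phi(rx)$. A finite $R$-$R$ bimodule $\mathcal A$ is Frobenius if $\mathcal A\cong\hat R$ both as left and as right $R$-modules. A weight $\mathbf w:\mathcal A\to\mathbb R$ with $\mathbf w(0)=0$ is homogeneous with average value $\gamma$ if $Rx=Ry$ implies $\mathbf w(x)=\mathbf w(y)$, and $\sum_{y\in Rx}\mathbf w(y)=\gamma|Rx|$ for all $0\ne x\in\mathcal A$; it is extended to $\mathcal A^n$ by $\mathbf w(c)=\sum_i\mathbf w(c_i)$. For $X\subseteq\mathcal A^n$, $\mathrm{supp}(X)=\{i:z_i\ne0\text{ for some }z\in X\}$. For an $R$-$R$ sub-bimodule $K$ of $\mathcal A^n$ the induced weight is $\hat{\mathbf w}(u+K)=\min\{\mathbf w(v):v\in u+K\}$, and the minimum distance of $C\subseteq\mathcal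 A^n/K$ is $\min\{\hat{\mathbf w}(x-y):x,y\in C,x\ne y\}$. $A(\mathcal A:n,s,\ell,d)$ is the maximum of $|C|$ over all $R$-$R$ sub-bimodules $K$ of $\mathcal A^n$ with $|\mathrm{supp}(K)|=\ell$ and all $C\subseteq\mathcal A^n/K$ with induced minimum distance $d$ and $|\mathrm{supp}(\bigcup_{x\in C}(x+K))|=s$. Then $\alpha(\mathcal A:\sigma,\lambda,\delta)=\limsup_{n\to\infty}n^{-1}\log_{|\mathcal A|}A(\mathcal A:n,\sigma n,\lambda n,\delta n)$. *)

theory Defs
  imports Complex_Main "HOL-Library.Extended_Real" "HOL-Library.Liminf_Limsup"
    "HOL-Library.Function_Algebras"
begin

text \<open>
  The finite ring is a type of classes finite and ring_1 (noncommutative, with 0 different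
  from 1). For the zero ring the only bimodule is 0, and logarithms to base 1 would be needed.
\<close>

locale bimodule =
  fixes lact :: "'r::{finite,ring_1} \<Rightarrow> 'a::{finite,ab_group_add} \<Rightarrow> 'a"
    and ract :: "'a \<Rightarrow> 'r \<Rightarrow> 'a"
  assumes lact_add_right: "lact r (x + y) = lact r x + lact r y"
    and lact_add_left: "lact (r + s) x = lact r x + lact s x"
    and lact_mult: "lact (r * s) x = lact r (lact s x)"
    and lact_one: "lact 1 x = x"
    and ract_add_left: "ract (x + y) r = ract x r + ract y r"
    and ract_add_right: "ract x (r + s) = ract x r + ract x s"
    and ract_mult: "ract x (r * s) = ract (ract x r) s"
    and ract_one: "ract x 1 = x"
    and act_assoc: "ract (lact r x) s = lact r (ract x s)"

definition characters :: "('r::ring_1 \<Rightarrow> complex) set" where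
  "characters = {\<phi>. (\<forall>x. \<phi> x \<noteq> 0) \<and> (\<forall>x y. \<phi> (x + y) = \<phi> x * \<phi> y)}"

definition char_lact :: "'r::ring_1 \<Rightarrow> ('r \<Rightarrow> complex) \<Rightarrow> 'r \<Rightarrow> complex" where
  "char_lact r \<phi> = (\<lambda>x. \<phi> (x * r))"

definition char_ract :: "('r::ring_1 \<Rightarrow> complex) \<Rightarrow> 'r \<Rightarrow> 'r \<Rightarrow> complex" where
  "char_ract \<phi> r = (\<lambda>x. \<phi> (r * x))"

text \<open>The group of characters is written multiplicatively, with the pointwise product.\<close>

locale frobenius_bimodule = bimodule lact ract
  for lact :: "'r::{finite,ring_1} \<Rightarrow> 'a::{finite,ab_group_add} \<Rightarrow> 'a"
    and ract :: "'a \<Rightarrow> 'r \<Rightarrow> 'a" +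
  assumes left_iso: "\<exists>f. bij_betw f UNIV (characters :: ('r \<Rightarrow> complex) set)
      \<and> (\<forall>a b. f (a + b) = (\<lambda>x. f a x * f b x))
      \<and> (\<forall>r a. f (lact r a) = char_lact r (f a))"
    and right_iso: "\<exists>f. bij_betw f UNIV (characters :: ('r \<Rightarrow> complex) set)
      \<and> (\<forall>a b. f (a + b) = (\<lambda>x. f a x * f b x))
      \<and> (\<forall>a r. f (ract a r) = char_ract (f a) r)"

definition homogeneous_weight ::
  "('r \<Rightarrow> 'a::zero \<Rightarrow> 'a) \<Rightarrow> ('a \<Rightarrow> real) \<Rightarrow> real \<Rightarrow> bool" where
  "homogeneous_weight lact w \<gamma> \<longleftrightarrow>
     w 0 = 0
     \<and> (\<forall>x y. range (\<lambda>r. lact r x) = range (\<lambda>r. lact r y) \<longrightarrow> w x = w y)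
     \<and> (\<forall>x. x \<noteq> 0 \<longrightarrow>
          (\<Sum>y\<in>range (\<lambda>r. lact r x). w y) = \<gamma> * real (card (range (\<lambda>r. lact r x))))"

text \<open>
  Since the length varies, the elements of the n-th power are the functions on the natural
  numbers that vanish from n on, with pointwise addition; the coordinates are 0, ..., n - 1.
\<close>

definition words :: "nat \<Rightarrow> (nat \<Rightarrow> 'a::zero) set" where
  "words n = {c. \<forall>i\<ge>n. c i = 0}"

definition weight :: "('a \<Rightarrow> real) \<Rightarrow> nat \<Rightarrow> (nat \<Rightarrow> 'a) \<Rightarrow> real" where
  "weight w n c = (\<Sum>i<n. w (c i))"

definition supp :: "nat \<Rightarrow> (nat \<Rightarrow> 'a::zero) set \<Rightarrow> nat set" where
  "supp n X = {i. i < n \<and> (\<exists>z\<in>X. z i \<noteq> 0)}"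

definition sub_bimodule ::
  "('r \<Rightarrow> 'a::ab_group_add \<Rightarrow> 'a) \<Rightarrow> ('a \<Rightarrow> 'r \<Rightarrow> 'a) \<Rightarrow> nat \<Rightarrow> (nat \<Rightarrow> 'a) set \<Rightarrow> bool" where
  "sub_bimodule lact ract n K \<longleftrightarrow>
     K \<subseteq> words n \<and> 0 \<in> K
     \<and> (\<forall>u\<in>K. \<forall>v\<in>K. u - v \<in> K)
     \<and> (\<forall>r. \<forall>u\<in>K. (\<lambda>i. lact r (u i)) \<in> K)
     \<and> (\<forall>r. \<forall>u\<in>K. (\<lambda>i. ract (u i) r) \<in> K)"

definition coset :: "(nat \<Rightarrow> 'a::ab_group_add) \<Rightarrow> (nat \<Rightarrow> 'a) set \<Rightarrow> (nat \<Rightarrow> 'a) set" where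
  "coset u K = (\<lambda>k. u + k) ` K"

definition quotient_words :: "nat \<Rightarrow> (nat \<Rightarrow> 'a::ab_group_add) set \<Rightarrow> (nat \<Rightarrow> 'a) set set" where
  "quotient_words n K = (\<lambda>u. coset u K) ` words n"

definition coset_diff ::
  "(nat \<Rightarrow> 'a::ab_group_add) set \<Rightarrow> (nat \<Rightarrow> 'a) set \<Rightarrow> (nat \<Rightarrow> 'a) set" where
  "coset_diff X Y = {u - v | u v. u \<in> X \<and> v \<in> Y}"

definition induced_weight :: "('a \<Rightarrow> real) \<Rightarrow> nat \<Rightarrow> (nat \<Rightarrow> 'a) set \<Rightarrow> real" where
  "induced_weight w n X = Min (weight w n ` X)"

text \<open>A code with fewer than two elements has no minimum distance.\<close>

definition has_min_distance ::
  "('a::ab_group_add \<Rightarrow> real) \<Rightarrow> nat \<Rightarrow> (nat \<Rightarrow> 'a) set set \<Rightarrow> real \<Rightarrow> bool" where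
  "has_min_distance w n C d \<longleftrightarrow>
     (\<exists>x\<in>C. \<exists>y\<in>C. x \<noteq> y)
     \<and> d = Min {induced_weight w n (coset_diff x y) | x y. x \<in> C \<and> y \<in> C \<and> x \<noteq> y}"

definition quotient_code ::
  "('r \<Rightarrow> 'a::ab_group_add \<Rightarrow> 'a) \<Rightarrow> ('a \<Rightarrow> 'r \<Rightarrow> 'a) \<Rightarrow> ('a \<Rightarrow> real) \<Rightarrow>
     nat \<Rightarrow> nat \<Rightarrow> nat \<Rightarrow> real \<Rightarrow> (nat \<Rightarrow> 'a) set \<Rightarrow> (nat \<Rightarrow> 'a) set set \<Rightarrow> bool" where
  "quotient_code lact ract w n s l d K C \<longleftrightarrow>
     sub_bimodule lact ract n K \<and> card (supp n K) = l
     \<and> C \<subseteq> quotient_words n K \<and> has_min_distance w n C d \<and> card (supp n (\<Union>C)) = s"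

text \<open>The supremum is a maximum when such a code exists, and 0 otherwise.\<close>

definition max_code_size ::
  "('r \<Rightarrow> 'a::ab_group_add \<Rightarrow> 'a) \<Rightarrow> ('a \<Rightarrow> 'r \<Rightarrow> 'a) \<Rightarrow> ('a \<Rightarrow> real) \<Rightarrow>
     nat \<Rightarrow> nat \<Rightarrow> nat \<Rightarrow> real \<Rightarrow> nat" where
  "max_code_size lact ract w n s l d = Sup {card C | K C. quotient_code lact ract w n s l d K C}"

definition min_distances ::
  "('r \<Rightarrow> 'a::ab_group_add \<Rightarrow> 'a) \<Rightarrow> ('a \<Rightarrow> 'r \<Rightarrow> 'a) \<Rightarrow> ('a \<Rightarrow> real) \<Rightarrow>
     nat \<Rightarrow> nat \<Rightarrow> nat \<Rightarrow> real set" where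
  "min_distances lact ract w n s l = {d. \<exists>K C. quotient_code lact ract w n s l d K C}"

text \<open>
  Minimum distances take only finitely many values for given n, s, l. A real number d is rounded
  up to the next such value; d is left unchanged if it is itself attained, or if no value above
  it is attained (there is then no code with minimum distance d).
\<close>

definition distance_ceiling ::
  "('r \<Rightarrow> 'a::ab_group_add \<Rightarrow> 'a) \<Rightarrow> ('a \<Rightarrow> 'r \<Rightarrow> 'a) \<Rightarrow> ('a \<Rightarrow> real) \<Rightarrow>
     nat \<Rightarrow> nat \<Rightarrow> nat \<Rightarrow> real \<Rightarrow> real" where
  "distance_ceiling lact ract w n s l d =
     (let D = {e \<in> min_distances lact ract w n s l. d \<le> e} in if D = {} then d else Min D)"

definition log_size :: "nat \<Rightarrow> nat \<Rightarrow> ereal" where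
  "log_size q m = (if m = 0 then -\<infinity> else ereal (log (real q) (real m)))"

text \<open>
  The products of n with the three real parameters are rounded to admissible values: to the
  integer part for the support sizes, and up to the next attained minimum distance. Where the
  products are themselves admissible, nothing is rounded.
\<close>

definition alpha ::
  "('r \<Rightarrow> 'a::{finite,ab_group_add} \<Rightarrow> 'a) \<Rightarrow> ('a \<Rightarrow> 'r \<Rightarrow> 'a) \<Rightarrow> ('a \<Rightarrow> real) \<Rightarrow>
     real \<Rightarrow> real \<Rightarrow> real \<Rightarrow> ereal" where
  "alpha lact ract w \<sigma> lam \<delta> =
     limsup (\<lambda>n. let s = nat \<lfloor>\<sigma> * real n\<rfloor>; l = nat \<lfloor>lam * real n\<rfloor>;
                     d = distance_ceiling lact ract w n s l (\<delta> * real n)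
                 in ereal (1 / real n) *
                    log_size (card (UNIV :: 'a set)) (max_code_size lact ract w n s l d))"

end

theory Submission
  imports Defs "HOL-Library.FuncSet"
begin

text \<open>
  A Frobenius bimodule carries a character \<chi> whose kernel contains no nonzero left submodule.
  Averaging \<gamma> (1 - Re \<chi>(u x)) over the units u gives a homogeneous weight, and there is only one:
  sums over cyclic submodules determine the sums over their sets of generators, on each of which a
  homogeneous weight is constant. The average depends only on Rx because two generators of a
  cyclic module over a finite ring differ by a unit, which follows from the same inversion carried
  out in the ring itself. Hence \<gamma> - w is an average of positive definite functions, so that the
  pairwise distances in a set of M words of length t sum up to at most \<gamma> t M^2. This is the Plotkin
  bound; it applies to codes of cosets since representatives are at least as far apart as their
  cosets. For \<gamma> \<tau> < \<delta>, fixing the letters on all but \<tau> n coordinates yields the exponent \<sigma> - \<tau>.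
  Take \<tau> = \<sigma> if \<delta> > \<gamma> \<sigma>, and let \<tau> tend to \<delta>/\<gamma> otherwise.
\<close>

section \<open>Additive characters\<close>

definition additive_character :: "('a::ab_group_add \<Rightarrow> complex) \<Rightarrow> bool" where
  "additive_character \<chi> \<longleftrightarrow> (\<forall>x. \<chi> x \<noteq> 0) \<and> (\<forall>x y. \<chi> (x + y) = \<chi> x * \<chi> y)"

lemma additive_character_nonzero: "additive_character \<chi> \<Longrightarrow> \<chi> x \<noteq> 0"
  by (simp add: additive_character_def)

lemma additive_character_add: "additive_character \<chi> \<Longrightarrow> \<chi> (x + y) = \<chi> x * \<chi> y"
  by (simp add: additive_character_def)

lemma additive_character_zero:
  assumes "additive_character \<chi>"
  shows "\<chi> 0 = 1"
  using additive_character_add[OF assms, of 0 0] additive_character_nonzero[OF assms, of 0] by simp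

lemma norm_additive_character:
  fixes \<chi> :: "'a::{finite,ab_group_add} \<Rightarrow> complex"
  assumes "additive_character \<chi>"
  shows "norm (\<chi> x) = 1"
proof -
  have "(\<Sum>y\<in>UNIV. norm (\<chi> y)) = (\<Sum>y\<in>UNIV. norm (\<chi> (x + y)))"
    by (rule sum.reindex_bij_witness[of _ "\<lambda>y. x + y" "\<lambda>y. y - x"]) auto
  also have "\<dots> = norm (\<chi> x) * (\<Sum>y\<in>UNIV. norm (\<chi> y))"
    by (simp add: additive_character_add[OF assms] norm_mult sum_distrib_left)
  finally have "norm (\<chi> x) = 1 \<or> (\<Sum>y\<in>UNIV. norm (\<chi> y)) = 0" by auto
  moreover have "(\<Sum>y\<in>UNIV. norm (\<chi> y)) > 0"
    using additive_character_nonzero[OF assms] by (intro sum_pos) auto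
  ultimately show ?thesis by simp
qed

lemma additive_character_minus:
  fixes \<chi> :: "'a::{finite,ab_group_add} \<Rightarrow> complex"
  assumes "additive_character \<chi>"
  shows "\<chi> (- x) = cnj (\<chi> x)"
proof -
  have "\<chi> x * \<chi> (- x) = 1"
    using additive_character_add[OF assms, of x "- x"] additive_character_zero[OF assms] by simp
  also have "\<dots> = \<chi> x * cnj (\<chi> x)"
    by (simp add: norm_additive_character[OF assms] flip: complex_norm_square)
  finally show ?thesis using additive_character_nonzero[OF assms, of x] by simp
qed

lemma sum_additive_character_eq_0:
  assumes "additive_character \<chi>" "\<And>x y. x \<in> G \<Longrightarrow> y \<in> G \<Longrightarrow> x - y \<in> G" "a \<in> G" "\<chi> a \<noteq> 1"
  shows "sum \<chi> G = 0"
proof -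
  have "0 \<in> G" using assms(2)[OF assms(3,3)] by simp
  then have closed: "a + x \<in> G" if "x \<in> G" for x
    using assms(2)[OF assms(3) assms(2)[of 0 x]] that by simp
  have "sum \<chi> G = (\<Sum>x\<in>G. \<chi> (a + x))"
    by (rule sum.reindex_bij_witness[of _ "\<lambda>x. a + x" "\<lambda>x. x - a"]) (use assms closed in auto)
  also have "\<dots> = \<chi> a * sum \<chi> G"
    by (simp add: additive_character_add[OF assms(1)] sum_distrib_left)
  finally show ?thesis using assms(4) by simp
qed

lemma sum_additive_character_differences_nonneg:
  fixes \<chi> :: "'a::{finite,ab_group_add} \<Rightarrow> complex"
  assumes "additive_character \<chi>"
  shows "0 \<le> (\<Sum>i\<in>I. \<Sum>j\<in>I. Re (\<chi> (a i - a j)))"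
proof -
  let ?S = "\<Sum>i\<in>I. \<chi> (a i)"
  have "\<chi> (a i - a j) = \<chi> (a i) * cnj (\<chi> (a j))" for i j
    using additive_character_add[OF assms, of "a i" "- a j"] additive_character_minus[OF assms]
    by simp
  then have "(\<Sum>i\<in>I. \<Sum>j\<in>I. Re (\<chi> (a i - a j))) = Re (?S * cnj ?S)"
    by (simp only: cnj_sum sum_product Re_sum)
  also have "\<dots> = (norm ?S)\<^sup>2" by (metis Re_complex_of_real complex_norm_square)
  finally show ?thesis by simp
qed

section \<open>Cyclic submodules and their generators\<close>

locale left_module =
  fixes lact :: "'r::ring_1 \<Rightarrow> 'a::ab_group_add \<Rightarrow> 'a"
  assumes lact_add_right: "lact r (x + y) = lact r x + lact r y"
    and lact_add_left: "lact (r + s) x = lact r x + lact s x"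
    and lact_mult: "lact (r * s) x = lact r (lact s x)"
    and lact_one [simp]: "lact 1 x = x"
begin

sublocale lact_right: additive "lact r" for r
  by unfold_locales (rule lact_add_right)

sublocale lact_left: additive "\<lambda>r. lact r x" for x
  by unfold_locales (rule lact_add_left)

abbreviation cyclic :: "'a \<Rightarrow> 'a set" where
  "cyclic x \<equiv> range (\<lambda>r. lact r x)"

definition generators :: "'a set \<Rightarrow> 'a set" where
  "generators N = {x. cyclic x = N}"

lemma self_in_cyclic: "x \<in> cyclic x"
  by (metis lact_one rangeI)

lemma cyclic_subset_iff: "cyclic x \<subseteq> cyclic y \<longleftrightarrow> x \<in> cyclic y"
proof
  assume "x \<in> cyclic y"
  then show "cyclic x \<subseteq> cyclic y" by (auto simp flip: lact_mult)
qed (use self_in_cyclic in blast)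

lemma cyclic_diff_closed: "y \<in> cyclic x \<Longrightarrow> z \<in> cyclic x \<Longrightarrow> y - z \<in> cyclic x"
  by (auto simp flip: lact_left.diff)

end

locale finite_left_module = left_module lact
  for lact :: "'r::{finite,ring_1} \<Rightarrow> 'a::{finite,ab_group_add} \<Rightarrow> 'a"
begin

lemma sum_cyclic_eq_sum_generators:
  "sum f (cyclic x) = (\<Sum>N\<in>cyclic ` cyclic x. sum f (generators N))"
proof -
  have "{z \<in> cyclic x. cyclic z = cyclic y} = generators (cyclic y)" if "y \<in> cyclic x" for y
    using that cyclic_subset_iff unfolding generators_def by blast
  then have "(\<Sum>N\<in>cyclic ` cyclic x. sum f {z \<in> cyclic x. cyclic z = N})
      = (\<Sum>N\<in>cyclic ` cyclic x. sum f (generators N))"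
    by (intro sum.cong refl arg_cong[where f = "sum f"]) blast
  then show ?thesis by (simp only: sum.image_gen[of "cyclic x" f cyclic] finite)
qed

text \<open>Moebius inversion on the poset of cyclic submodules.\<close>

lemma sum_generators_cyclic_eqI:
  fixes f g :: "'a \<Rightarrow> 'b::cancel_comm_monoid_add"
  assumes "\<And>x. sum f (cyclic x) = sum g (cyclic x)"
  shows "sum f (generators (cyclic x)) = sum g (generators (cyclic x))"
proof (induction "card (cyclic x)" arbitrary: x rule: less_induct)
  case less
  let ?proper = "cyclic ` cyclic x - {cyclic x}"
  have sum_split:
    "sum h (cyclic x) = sum h (generators (cyclic x)) + (\<Sum>N\<in>?proper. sum h (generators N))"
    for h :: "'a \<Rightarrow> 'b"
  proof -
    have "sum h (cyclic x) = (\<Sum>N\<in>cyclic ` cyclic x. sum h (generators N))"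
      by (rule sum_cyclic_eq_sum_generators)
    also have "\<dots> = sum h (generators (cyclic x)) + (\<Sum>N\<in>?proper. sum h (generators N))"
      by (rule sum.remove[OF finite imageI[OF self_in_cyclic]])
    finally show ?thesis .
  qed
  have "sum f (generators N) = sum g (generators N)" if N: "N \<in> ?proper" for N
  proof -
    obtain y where y: "y \<in> cyclic x" "N = cyclic y" "N \<noteq> cyclic x" using N by blast
    then have "card (cyclic y) < card (cyclic x)"
      using cyclic_subset_iff[of y x] by (intro psubset_card_mono psubsetI) simp_all
    then show ?thesis using less y(2) by simp
  qed
  then show ?case using assms[of x] unfolding sum_split by simp
qed

end

interpretation regular: finite_left_module "(*) :: 'r::{finite,ring_1} \<Rightarrow> 'r \<Rightarrow> 'r"
  by unfold_locales (simp_all add: algebra_simps)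

section \<open>Generators of a cyclic module differ by a unit\<close>

definition units :: "'r::ring_1 set" where
  "units = {u. \<exists>v. v * u = 1 \<and> u * v = 1}"

lemma one_in_units: "1 \<in> units"
  unfolding units_def by auto

lemma units_mult:
  assumes "u \<in> units" "u' \<in> units"
  shows "u * u' \<in> units"
proof -
  obtain v v' where inverse: "v * u = 1" "u * v = 1" "v' * u' = 1" "u' * v' = 1"
    using assms unfolding units_def by auto
  have "(v' * v) * (u * u') = v' * (v * u) * u'" "(u * u') * (v' * v) = u * (u' * v') * v"
    by (simp_all only: mult.assoc)
  then have "(v' * v) * (u * u') = 1 \<and> (u * u') * (v' * v) = 1" by (simp add: inverse)
  then show ?thesis unfolding units_def by blast
qed

lemma bij_betw_units_mult:
  assumes "u \<in> units"
  shows "bij_betw (\<lambda>v. v * u) units units"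
proof -
  obtain v where v: "v * u = 1" "u * v = 1" using assms unfolding units_def by auto
  then have "v \<in> units" unfolding units_def by auto
  then show ?thesis
    using assms v by (intro bij_betwI[where g = "\<lambda>x. x * v"]) (auto simp: units_mult mult.assoc)
qed

lemma left_inverse_imp_unit:
  fixes u v :: "'r::{finite,ring_1}"
  assumes "v * u = 1"
  shows "u \<in> units"
proof -
  have "v * (u * r) = r" for r by (simp add: assms flip: mult.assoc)
  then have "inj ((*) u)" by (rule inj_on_inverseI)
  then have "surj ((*) u)" by (simp add: finite_UNIV_inj_surj)
  then obtain r where r: "1 = u * r" by (rule surjE)
  have "v = v * (u * r)" by (simp flip: r)
  also have "\<dots> = r" by (simp add: assms flip: mult.assoc)
  finally show ?thesis using assms r unfolding units_def by auto
qed

lemma generators_UNIV_eq_units: "regular.generators UNIV = (units :: 'r::{finite,ring_1} set)"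
proof (intro set_eqI iffI)
  fix u :: 'r assume "u \<in> regular.generators UNIV"
  then have "surj (\<lambda>r. r * u)" by (simp add: regular.generators_def)
  then obtain v where "1 = v * u" by (rule surjE)
  then show "u \<in> units" using left_inverse_imp_unit by metis
next
  fix u :: 'r assume "u \<in> units"
  then obtain v where "v * u = 1" unfolding units_def by auto
  then have "(r * v) * u = r" for r by (simp add: mult.assoc)
  then have "surj (\<lambda>r. r * u)" by (rule surjI)
  then show "u \<in> regular.generators UNIV" by (simp add: regular.generators_def)
qed

lemma (in additive) card_fibre_eq_card_kernel:
  assumes closed: "\<And>x y. x \<in> G \<Longrightarrow> y \<in> G \<Longrightarrow> x - y \<in> G" and a: "a \<in> G"
  shows "card {x \<in> G. f x = f a} = card {x \<in> G. f x = 0}"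
proof (rule bij_betw_same_card[OF bij_betwI])
  have "0 - a \<in> G" using closed[OF closed[OF a a] a] by simp
  then show "(\<lambda>x. x + a) \<in> {x \<in> G. f x = 0} \<rightarrow> {x \<in> G. f x = f a}"
    using closed[of _ "0 - a"] by (auto simp: add zero)
  show "(\<lambda>x. x - a) \<in> {x \<in> G. f x = f a} \<rightarrow> {x \<in> G. f x = 0}"
    using closed a by (auto simp: diff)
qed simp_all

context finite_left_module
begin

lemma card_solutions_in_left_ideal:
  "card {u \<in> regular.cyclic v. lact u y = z} =
    (if z \<in> cyclic (lact v y) then card {u \<in> regular.cyclic v. lact u y = 0} else 0)"
proof (cases "z \<in> cyclic (lact v y)")
  case True
  then obtain r where "z = lact (r * v) y" by (auto simp: lact_mult)
  then show ?thesis
    using True lact_left.card_fibre_eq_card_kernel[OF regular.cyclic_diff_closed] by simp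
next
  case False
  then have "{u \<in> regular.cyclic v. lact u y = z} = {}" by (auto simp: lact_mult)
  then show ?thesis using False by simp
qed

lemma cyclic_eq_imp_unit_multiple:
  assumes "cyclic x = cyclic y"
  obtains u where "u \<in> units" "x = lact u y"
proof -
  have sum_of_bool_eq_card: "(\<Sum>u\<in>A. of_bool (lact u y = z)) = card {u \<in> A. lact u y = z}" for A z
    by (simp add: Int_def)
  have "x \<in> cyclic z \<longleftrightarrow> y \<in> cyclic z" for z
    using assms by (simp flip: cyclic_subset_iff)
  then have "card {u \<in> regular.cyclic v. lact u y = x} = card {u \<in> regular.cyclic v. lact u y = y}"
    for v
    by (simp only: card_solutions_in_left_ideal[of v y x] card_solutions_in_left_ideal[of v y y])
  then have "(\<Sum>u\<in>regular.generators (regular.cyclic 1). of_bool (lact u y = x) :: nat)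
      = (\<Sum>u\<in>regular.generators (regular.cyclic 1). of_bool (lact u y = y))"
    by (intro regular.sum_generators_cyclic_eqI) (simp only: sum_of_bool_eq_card)
  then have "card {u \<in> units. lact u y = x} = card {u \<in> units. lact u y = y}"
    by (simp only: sum_of_bool_eq_card mult_1_right surj_id generators_UNIV_eq_units flip: id_def)
  moreover have "1 \<in> {u \<in> units. lact u y = y}" by (simp add: one_in_units)
  then have "card {u \<in> units. lact u y = y} > 0" by (auto simp: card_gt_0_iff)
  ultimately have "{u \<in> units. lact u y = x} \<noteq> {}" by (metis card.empty less_irrefl)
  then show thesis using that by blast
qed

end

section \<open>The homogeneous weight as an average of characters\<close>

context finite_left_module
begin

lemma sum_homogeneous_weight_cyclic:
  assumes "homogeneous_weight lact w \<gamma>"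
  shows "sum w (cyclic x) = (if x = 0 then 0 else \<gamma> * real (card (cyclic x)))"
proof (cases "x = 0")
  case True
  have "w 0 = 0" using assms unfolding homogeneous_weight_def by blast
  then show ?thesis using True by (simp add: lact_right.zero)
next
  case False
  then have "sum w (cyclic x) = \<gamma> * real (card (cyclic x))"
    using assms unfolding homogeneous_weight_def by blast
  then show ?thesis using False by (simp only: if_False)
qed

lemma homogeneous_weight_cyclic_cong:
  "homogeneous_weight lact w \<gamma> \<Longrightarrow> cyclic x = cyclic y \<Longrightarrow> w x = w y"
  unfolding homogeneous_weight_def by blast

lemma homogeneous_weight_unique:
  assumes "homogeneous_weight lact v \<gamma>" "homogeneous_weight lact w \<gamma>"
  shows "v = w"
proof
  fix x
  have "sum v (generators (cyclic x)) = sum w (generators (cyclic x))"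
    by (rule sum_generators_cyclic_eqI) (simp only: assms[THEN sum_homogeneous_weight_cyclic])
  moreover have "sum h (generators (cyclic x)) = real (card (generators (cyclic x))) * h x"
    if "homogeneous_weight lact h \<gamma>" for h
  proof -
    have "sum h (generators (cyclic x)) = (\<Sum>y\<in>generators (cyclic x). h x)"
      by (intro sum.cong refl homogeneous_weight_cyclic_cong[OF that]) (simp add: generators_def)
    then show ?thesis by simp
  qed
  moreover have "generators (cyclic x) \<noteq> {}" unfolding generators_def by blast
  ultimately show "v x = w x" using assms by simp
qed

definition generating_character :: "('a \<Rightarrow> complex) \<Rightarrow> bool" where
  "generating_character \<chi> \<longleftrightarrow> additive_character \<chi> \<and> (\<forall>x. (\<forall>r. \<chi> (lact r x) = 1) \<longrightarrow> x = 0)"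

definition unit_average :: "('a \<Rightarrow> complex) \<Rightarrow> 'a \<Rightarrow> real" where
  "unit_average \<chi> x = (\<Sum>u\<in>units. Re (\<chi> (lact u x))) / real (card (units :: 'r set))"

lemma unit_average_zero:
  assumes "additive_character \<chi>"
  shows "unit_average \<chi> 0 = 1"
proof -
  have "card (units :: 'r set) \<noteq> 0" using one_in_units by (auto simp: card_eq_0_iff)
  then show ?thesis
    unfolding unit_average_def by (simp add: lact_right.zero additive_character_zero[OF assms])
qed

lemma unit_average_cyclic_cong:
  assumes "cyclic x = cyclic y"
  shows "unit_average \<chi> x = unit_average \<chi> y"
proof -
  obtain v where v: "v \<in> units" "x = lact v y" using cyclic_eq_imp_unit_multiple[OF assms] .
  have "(\<Sum>u\<in>units. Re (\<chi> (lact u x))) = (\<Sum>u\<in>units. Re (\<chi> (lact (u * v) y)))"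
    by (simp add: v(2) lact_mult)
  also have "\<dots> = (\<Sum>u\<in>units. Re (\<chi> (lact u y)))"
    by (rule sum.reindex_bij_betw[OF bij_betw_units_mult[OF v(1)]])
  finally show ?thesis by (simp add: unit_average_def)
qed

lemma additive_character_lact:
  "additive_character \<chi> \<Longrightarrow> additive_character (\<lambda>x. \<chi> (lact r x))"
  by (simp add: additive_character_def lact_add_right)

lemma sum_unit_average_cyclic:
  assumes "generating_character \<chi>" "x \<noteq> 0"
  shows "sum (unit_average \<chi>) (cyclic x) = 0"
proof -
  have \<chi>: "additive_character \<chi>" using assms(1) by (simp add: generating_character_def)
  obtain r where r: "\<chi> (lact r x) \<noteq> 1" using assms unfolding generating_character_def by blast
  have unit: "(\<Sum>y\<in>cyclic x. \<chi> (lact u y)) = 0" if u: "u \<in> units" for u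
  proof -
    obtain v where "u * v = 1" using u unfolding units_def by auto
    then have "\<chi> (lact u (lact (v * r) x)) \<noteq> 1" using r by (simp flip: lact_mult mult.assoc)
    then show ?thesis
      by (intro sum_additive_character_eq_0[OF additive_character_lact[OF \<chi>] cyclic_diff_closed])
        auto
  qed
  have "(\<Sum>y\<in>cyclic x. \<Sum>u\<in>units. Re (\<chi> (lact u y)))
      = (\<Sum>u\<in>units. Re (\<Sum>y\<in>cyclic x. \<chi> (lact u y)))"
    by (subst sum.swap) simp
  also have "\<dots> = 0" by (simp del: Re_sum add: unit)
  finally show ?thesis unfolding unit_average_def by (simp flip: sum_divide_distrib)
qed

lemma homogeneous_weight_unit_average:
  assumes "generating_character \<chi>"
  shows "homogeneous_weight lact (\<lambda>x. \<gamma> * (1 - unit_average \<chi> x)) \<gamma>"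
  unfolding homogeneous_weight_def
proof (intro conjI allI impI)
  show "\<gamma> * (1 - unit_average \<chi> 0) = 0"
    using assms by (simp add: generating_character_def unit_average_zero)
  show "\<gamma> * (1 - unit_average \<chi> x) = \<gamma> * (1 - unit_average \<chi> y)" if "cyclic x = cyclic y" for x y
    by (simp only: unit_average_cyclic_cong[OF that])
  show "(\<Sum>y\<in>cyclic x. \<gamma> * (1 - unit_average \<chi> y)) = \<gamma> * real (card (cyclic x))" if "x \<noteq> 0" for x
    using sum_unit_average_cyclic[OF assms that] by (simp add: sum_subtractf flip: sum_distrib_left)
qed

lemma sum_unit_average_differences_nonneg:
  assumes "additive_character \<chi>"
  shows "0 \<le> (\<Sum>i\<in>I. \<Sum>j\<in>I. unit_average \<chi> (a i - a j))"
proof -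
  have "0 \<le> (\<Sum>i\<in>I. \<Sum>j\<in>I. Re (\<chi> (lact u (a i - a j))))" for u
    by (rule sum_additive_character_differences_nonneg[OF additive_character_lact[OF assms]])
  then have "0 \<le> (\<Sum>u\<in>units. \<Sum>i\<in>I. \<Sum>j\<in>I. Re (\<chi> (lact u (a i - a j))))"
    by (rule sum_nonneg)
  also have "\<dots> = (\<Sum>i\<in>I. \<Sum>j\<in>I. \<Sum>u\<in>units. Re (\<chi> (lact u (a i - a j))))"
    by (simp add: sum.swap[of _ units])
  finally show ?thesis
    unfolding unit_average_def by (simp flip: sum_divide_distrib)
qed

end

section \<open>The Plotkin bound\<close>

locale mean_distance_bound =
  fixes w :: "'a::ab_group_add \<Rightarrow> real" and \<gamma> :: real
  assumes weight_zero: "w 0 = 0"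
    and sum_distances_lessThan_le: "(\<Sum>j<m. \<Sum>k<m. w (a j - a k)) \<le> \<gamma> * (real m)\<^sup>2"
begin

lemma bound_nonneg: "0 \<le> \<gamma>"
  using sum_distances_lessThan_le[where m = 1 and a = "\<lambda>_. 0"] by (simp add: weight_zero)

lemma sum_distances_le:
  assumes "finite X"
  shows "(\<Sum>x\<in>X. \<Sum>y\<in>X. w (a x - a y)) \<le> \<gamma> * (real (card X))\<^sup>2"
proof -
  obtain h where h: "bij_betw h {..<card X} X"
    using ex_bij_betw_nat_finite[OF assms] by (auto simp: atLeast0LessThan)
  have "(\<Sum>x\<in>X. \<Sum>y\<in>X. w (a x - a y)) = (\<Sum>j<card X. \<Sum>k<card X. w (a (h j) - a (h k)))"
    by (simp add: sum.reindex_bij_betw[OF h, symmetric])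
  also have "\<dots> \<le> \<gamma> * (real (card X))\<^sup>2" by (rule sum_distances_lessThan_le)
  finally show ?thesis .
qed

lemma plotkin_bound:
  fixes X :: "('i \<Rightarrow> 'a) set"
  assumes "finite X"
    and dist: "\<And>x y. x \<in> X \<Longrightarrow> y \<in> X \<Longrightarrow> x \<noteq> y \<Longrightarrow> D \<le> (\<Sum>i\<in>T. w (x i - y i))"
    and D: "\<gamma> * real (card T) < D"
  shows "real (card X) \<le> D / (D - \<gamma> * real (card T))"
proof -
  let ?M = "real (card X)"
  have "?M * ((?M - 1) * D) = (\<Sum>x\<in>X. \<Sum>y\<in>X - {x}. D)"
    using \<open>finite X\<close> by (cases "X = {}") (simp_all add: of_nat_diff Suc_leI card_gt_0_iff)
  also have "\<dots> \<le> (\<Sum>x\<in>X. \<Sum>y\<in>X - {x}. \<Sum>i\<in>T. w (x i - y i))"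
    by (intro sum_mono dist) auto
  also have "\<dots> = (\<Sum>x\<in>X. \<Sum>y\<in>X. \<Sum>i\<in>T. w (x i - y i))"
    by (intro sum.cong refl sum.mono_neutral_left) (auto simp: \<open>finite X\<close> weight_zero)
  also have "\<dots> = (\<Sum>i\<in>T. \<Sum>x\<in>X. \<Sum>y\<in>X. w (x i - y i))"
    by (simp add: sum.swap[of _ T])
  also have "\<dots> \<le> (\<Sum>i\<in>T. \<gamma> * ?M\<^sup>2)"
    by (intro sum_mono sum_distances_le \<open>finite X\<close>)
  finally have "?M * (?M * (D - \<gamma> * real (card T))) \<le> ?M * D"
    by (simp add: power2_eq_square algebra_simps)
  moreover have "0 \<le> \<gamma> * real (card T)" using bound_nonneg by simp
  ultimately have "?M * (D - \<gamma> * real (card T)) \<le> D"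
    using D by (cases "card X = 0") simp_all
  then show ?thesis using D by (simp add: field_simps)
qed

end

lemma (in finite_left_module) mean_distance_bound_homogeneous_weight:
  assumes "generating_character \<chi>" "homogeneous_weight lact w \<gamma>" "\<gamma> \<ge> 0"
  shows "mean_distance_bound w \<gamma>"
proof
  show "w 0 = 0" using assms(2) by (simp add: homogeneous_weight_def)
  have \<chi>: "additive_character \<chi>" using assms(1) by (simp add: generating_character_def)
  have w: "w = (\<lambda>x. \<gamma> * (1 - unit_average \<chi> x))"
    by (rule homogeneous_weight_unique[OF assms(2) homogeneous_weight_unit_average[OF assms(1)]])
  fix m :: nat and a :: "nat \<Rightarrow> 'a"
  have "(\<Sum>j<m. \<Sum>k<m. w (a j - a k))
      = \<gamma> * ((real m)\<^sup>2 - (\<Sum>j<m. \<Sum>k<m. unit_average \<chi> (a j - a k)))"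
    by (simp add: w sum_subtractf power2_eq_square flip: sum_distrib_left)
  also have "\<dots> \<le> \<gamma> * (real m)\<^sup>2"
    using sum_unit_average_differences_nonneg[OF \<chi>] assms(3) by (intro mult_left_mono) simp_all
  finally show "(\<Sum>j<m. \<Sum>k<m. w (a j - a k)) \<le> \<gamma> * (real m)\<^sup>2" .
qed

lemma (in bimodule) finite_left_module: "finite_left_module lact"
  by unfold_locales (simp_all add: lact_add_right lact_add_left lact_mult lact_one)

lemma (in frobenius_bimodule) ex_generating_character:
  "\<exists>\<chi>. finite_left_module.generating_character lact \<chi>"
proof -
  interpret left: finite_left_module lact by (rule finite_left_module)
  obtain f where f: "bij_betw f UNIV (characters :: ('r \<Rightarrow> complex) set)"
    and add: "\<And>a b. f (a + b) = (\<lambda>x. f a x * f b x)"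
    and act: "\<And>r a. f (lact r a) = char_lact r (f a)"
    using left_iso by blast
  have nonzero: "f a r \<noteq> 0" for a r
    using bij_betwE[OF f] unfolding characters_def by blast
  have "f 0 = (\<lambda>r. 1)"
    using add[of 0 0] nonzero[of 0] by (auto simp: fun_eq_iff)
  then have "f x = f 0" if "\<And>r. f (lact r x) 1 = 1" for x
    using that by (simp add: act char_lact_def fun_eq_iff)
  then have "x = 0" if "\<And>r. f (lact r x) 1 = 1" for x
    using that f unfolding bij_betw_def by (metis injD)
  then have "left.generating_character (\<lambda>x. f x 1)"
    unfolding left.generating_character_def additive_character_def by (simp add: nonzero add)
  then show ?thesis by blast
qed

lemma (in frobenius_bimodule) mean_distance_bound_homogeneous_weight:
  assumes "homogeneous_weight lact w \<gamma>" "\<gamma> \<ge> 0"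
  shows "mean_distance_bound w \<gamma>"
proof -
  interpret left: finite_left_module lact by (rule finite_left_module)
  obtain \<chi> where \<chi>: "left.generating_character \<chi>" using ex_generating_character ..
  show ?thesis by (rule left.mean_distance_bound_homogeneous_weight[OF \<chi> assms])
qed

lemma plotkin_bound_shortened:
  fixes w :: "'a::{finite,ab_group_add} \<Rightarrow> real" and X :: "('i \<Rightarrow> 'a) set"
  assumes w: "mean_distance_bound w \<gamma>" and fin: "finite X" "finite S" "T \<subseteq> S"
    and dist: "\<And>x y. x \<in> X \<Longrightarrow> y \<in> X \<Longrightarrow> x \<noteq> y \<Longrightarrow> D \<le> (\<Sum>i\<in>S. w (x i - y i))"
    and D: "\<gamma> * real (card T) < D"
  shows "real (card X)
    \<le> real (card (UNIV :: 'a set)) ^ (card S - card T) * (D / (D - \<gamma> * real (card T)))"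
proof -
  interpret mean_distance_bound w \<gamma> by fact
  let ?words = "S - T \<rightarrow>\<^sub>E (UNIV :: 'a set)"
  have "finite ?words" using fin by (intro finite_PiE) auto
  moreover have "(\<lambda>x. restrict x (S - T)) \<in> X \<rightarrow> ?words" by auto
  moreover have "?words \<noteq> {}" by (simp add: PiE_eq_empty_iff)
  ultimately have "\<exists>p\<in>?words. card X \<le> card ((\<lambda>x. restrict x (S - T)) -` {p} \<inter> X) * card ?words"
    by (intro pigeonhole_card \<open>finite X\<close>)
  then obtain p where
    p: "card X \<le> card ((\<lambda>x. restrict x (S - T)) -` {p} \<inter> X) * card ?words" ..
  let ?fibre = "(\<lambda>x. restrict x (S - T)) -` {p} \<inter> X"
  have "real (card ?fibre) \<le> D / (D - \<gamma> * real (card T))"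
  proof (rule plotkin_bound[OF _ _ D])
    fix x y assume xy: "x \<in> ?fibre" "y \<in> ?fibre" "x \<noteq> y"
    have "x i = y i" if "i \<in> S - T" for i
      using xy that by (metis (mono_tags, lifting) IntE restrict_apply' vimage_singleton_eq)
    then have "(\<Sum>i\<in>S. w (x i - y i)) = (\<Sum>i\<in>T. w (x i - y i))"
      by (intro sum.mono_neutral_right fin) (simp add: weight_zero)
    then show "D \<le> (\<Sum>i\<in>T. w (x i - y i))" using dist[of x y] xy by simp
  qed (simp add: \<open>finite X\<close>)
  then have "real (card ?fibre * card ?words) \<le> D / (D - \<gamma> * real (card T)) * real (card ?words)"
    unfolding of_nat_mult by (rule mult_right_mono) simp
  moreover have "card ?words = card (UNIV :: 'a set) ^ (card S - card T)"
    using fin by (simp add: card_PiE card_Diff_subset finite_subset)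
  moreover have "real (card X) \<le> real (card ?fibre * card ?words)"
    using p by (simp only: of_nat_le_iff)
  ultimately show ?thesis by (simp add: mult.commute)
qed

section \<open>Codes of cosets\<close>

lemma finite_words: "finite (words n :: (nat \<Rightarrow> 'a::{finite,zero}) set)"
proof -
  have "words n = {f :: nat \<Rightarrow> 'a. \<forall>i. (i \<in> {..<n} \<longrightarrow> f i \<in> UNIV) \<and> (i \<notin> {..<n} \<longrightarrow> f i = 0)}"
    unfolding words_def by auto
  then show ?thesis by (simp only: finite_set_of_finite_funs finite_lessThan finite)
qed

lemma coset_subset_words:
  assumes "sub_bimodule lact ract n K" "u \<in> words n"
  shows "coset u K \<subseteq> words n"
  using assms unfolding sub_bimodule_def coset_def words_def by fastforce

lemma self_in_coset: "sub_bimodule lact ract n K \<Longrightarrow> u \<in> coset u K"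
  unfolding sub_bimodule_def coset_def by force

lemma coset_diff_subset_words: "X \<subseteq> words n \<Longrightarrow> Y \<subseteq> words n \<Longrightarrow> coset_diff X Y \<subseteq> words n"
  unfolding coset_diff_def words_def by fastforce

lemma quotient_code_subset_Pow_words:
  "quotient_code lact ract w n s l d K C \<Longrightarrow> C \<subseteq> Pow (words n)"
  unfolding quotient_code_def quotient_words_def using coset_subset_words by blast

lemma finite_quotient_code:
  fixes C :: "(nat \<Rightarrow> 'a::{finite,ab_group_add}) set set"
  shows "quotient_code lact ract w n s l d K C \<Longrightarrow> finite C"
  using quotient_code_subset_Pow_words finite_words by (metis finite_Pow_iff finite_subset)

definition code_distances ::
  "('a::ab_group_add \<Rightarrow> real) \<Rightarrow> nat \<Rightarrow> (nat \<Rightarrow> 'a) set set \<Rightarrow> real set" where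
  "code_distances w n C = {induced_weight w n (coset_diff x y) | x y. x \<in> C \<and> y \<in> C \<and> x \<noteq> y}"

lemma finite_code_distances:
  assumes "finite C"
  shows "finite (code_distances w n C)"
proof (rule finite_subset)
  show "code_distances w n C \<subseteq> (\<lambda>(x, y). induced_weight w n (coset_diff x y)) ` (C \<times> C)"
    unfolding code_distances_def by auto
qed (use assms in simp)

lemma min_distance_eq_Min_code_distances:
  "quotient_code lact ract w n s l d K C \<Longrightarrow> d = Min (code_distances w n C)"
  unfolding quotient_code_def has_min_distance_def code_distances_def by blast

lemma finite_min_distances:
  fixes lact :: "'r \<Rightarrow> 'a::{finite,ab_group_add} \<Rightarrow> 'a"
  shows "finite (min_distances lact ract w n s l)"
proof (rule finite_surj)
  show "finite (Pow (Pow (words n :: (nat \<Rightarrow> 'a) set)))" by (simp add: finite_words)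
  show "min_distances lact ract w n s l \<subseteq> (\<lambda>C. Min (code_distances w n C)) ` Pow (Pow (words n))"
    unfolding min_distances_def
    using min_distance_eq_Min_code_distances quotient_code_subset_Pow_words by fast
qed

lemma distance_ceiling_ge:
  fixes lact :: "'r \<Rightarrow> 'a::{finite,ab_group_add} \<Rightarrow> 'a"
  shows "d \<le> distance_ceiling lact ract w n s l d"
  using finite_min_distances[of lact ract w n s l] unfolding distance_ceiling_def Let_def by simp

lemma min_distance_le_weight_diff:
  fixes C :: "(nat \<Rightarrow> 'a::{finite,ab_group_add}) set set"
  assumes code: "quotient_code lact ract w n s l d K C"
    and xy: "x \<in> C" "y \<in> C" "x \<noteq> y" and uv: "u \<in> x" "v \<in> y"
  shows "d \<le> weight w n (u - v)"
proof -
  have "d = Min (code_distances w n C)" by (rule min_distance_eq_Min_code_distances[OF code])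
  also have "\<dots> \<le> induced_weight w n (coset_diff x y)"
    using xy finite_code_distances[OF finite_quotient_code[OF code]]
    by (auto simp: code_distances_def intro!: Min_le)
  also have "\<dots> \<le> weight w n (u - v)"
    unfolding induced_weight_def
  proof (rule Min_le)
    have "coset_diff x y \<subseteq> words n"
      using quotient_code_subset_Pow_words[OF code] xy by (intro coset_diff_subset_words) auto
    then show "finite (weight w n ` coset_diff x y)"
      using finite_words finite_subset by blast
    show "weight w n (u - v) \<in> weight w n ` coset_diff x y"
      unfolding coset_diff_def using uv by blast
  qed
  finally show ?thesis .
qed

lemma weight_diff_eq_sum_supp:
  fixes w :: "'a::ab_group_add \<Rightarrow> real"
  assumes "w 0 = 0" "u \<in> X" "v \<in> X"
  shows "weight w n (u - v) = (\<Sum>i\<in>supp n X. w (u i - v i))"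
  unfolding weight_def fun_diff_def
proof (rule sum.mono_neutral_right)
  show "\<forall>i\<in>{..<n} - supp n X. w (u i - v i) = 0"
  proof
    fix i assume "i \<in> {..<n} - supp n X"
    then have "u i = 0 \<and> v i = 0" using assms(2,3) unfolding supp_def by blast
    then show "w (u i - v i) = 0" using assms(1) by simp
  qed
qed (auto simp: supp_def)

lemma quotient_code_representatives:
  fixes C :: "(nat \<Rightarrow> 'a::{finite,ab_group_add}) set set"
  assumes code: "quotient_code lact ract w n s l d K C" and "w 0 = 0"
  obtains X where "finite X" "card X = card C"
    "\<And>u v. u \<in> X \<Longrightarrow> v \<in> X \<Longrightarrow> u \<noteq> v \<Longrightarrow> d \<le> (\<Sum>i\<in>supp n (\<Union>C). w (u i - v i))"
proof -
  have K: "sub_bimodule lact ract n K" and "C \<subseteq> (\<lambda>u. coset u K) ` words n"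
    using code unfolding quotient_code_def quotient_words_def by auto
  then obtain X where X: "X \<subseteq> words n" "inj_on (\<lambda>u. coset u K) X" "C = (\<lambda>u. coset u K) ` X"
    unfolding subset_image_inj by blast
  show thesis
  proof
    show "finite X" using X(1) finite_words finite_subset by blast
    show "card X = card C" unfolding X(3) by (rule card_image[OF X(2), symmetric])
  next
    fix u v assume uv: "u \<in> X" "v \<in> X" "u \<noteq> v"
    have cosets: "coset u K \<in> C" "coset v K \<in> C" "coset u K \<noteq> coset v K"
      using uv X by (auto dest: inj_onD)
    then have "d \<le> weight w n (u - v)"
      using min_distance_le_weight_diff[OF code] self_in_coset[OF K] by blast
    also have "\<dots> = (\<Sum>i\<in>supp n (\<Union>C). w (u i - v i))"
      using cosets self_in_coset[OF K] by (intro weight_diff_eq_sum_supp \<open>w 0 = 0\<close>) blast+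
    finally show "d \<le> (\<Sum>i\<in>supp n (\<Union>C). w (u i - v i))" .
  qed
qed

lemma real_Sup_nat_le:
  fixes A :: "nat set"
  assumes "\<And>m. m \<in> A \<Longrightarrow> real m \<le> B" "0 \<le> B"
  shows "real (Sup A) \<le> B"
proof (cases "A = {}")
  case False
  then have "Sup A \<le> nat \<lfloor>B\<rfloor>" using assms(1) by (intro cSup_least le_nat_floor)
  then show ?thesis using assms(2) by linarith
qed (use assms(2) in simp)

lemma max_code_size_le:
  fixes lact :: "'r \<Rightarrow> 'a::{finite,ab_group_add} \<Rightarrow> 'a"
  assumes w: "mean_distance_bound w \<gamma>" and "D \<le> d" "t \<le> s" and D: "\<gamma> * real t < D"
  shows "real (max_code_size lact ract w n s l d)
    \<le> real (card (UNIV :: 'a set)) ^ (s - t) * (D / (D - \<gamma> * real t))"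
  unfolding max_code_size_def
proof (rule real_Sup_nat_le)
  interpret mean_distance_bound w \<gamma> by fact
  have "0 \<le> \<gamma> * real t" using bound_nonneg by simp
  then show "0 \<le> real (card (UNIV :: 'a set)) ^ (s - t) * (D / (D - \<gamma> * real t))"
    using D by simp
  fix m assume "m \<in> {card C | K C. quotient_code lact ract w n s l d K C}"
  then obtain K C where code: "quotient_code lact ract w n s l d K C" and m: "m = card C" by blast
  obtain X where X: "finite X" "card X = card C"
    and dist: "\<And>u v. u \<in> X \<Longrightarrow> v \<in> X \<Longrightarrow> u \<noteq> v \<Longrightarrow> d \<le> (\<Sum>i\<in>supp n (\<Union>C). w (u i - v i))"
    using quotient_code_representatives[OF code weight_zero] by blast
  have s: "card (supp n (\<Union>C)) = s" using code unfolding quotient_code_def by simp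
  then obtain T where T: "T \<subseteq> supp n (\<Union>C)" "card T = t"
    using \<open>t \<le> s\<close> by (metis obtain_subset_with_card_n)
  show "real m \<le> real (card (UNIV :: 'a set)) ^ (s - t) * (D / (D - \<gamma> * real t))"
    unfolding m X(2)[symmetric] s[symmetric] T(2)[symmetric]
  proof (rule plotkin_bound_shortened[OF w X(1) _ T(1)])
    show "finite (supp n (\<Union>C))" by (simp add: supp_def)
    show "D \<le> (\<Sum>i\<in>supp n (\<Union>C). w (u i - v i))" if "u \<in> X" "v \<in> X" "u \<noteq> v" for u v
      using dist[OF that] \<open>D \<le> d\<close> by simp
    show "\<gamma> * real (card T) < D" using D T(2) by simp
  qed
qed

section \<open>The asymptotic bound\<close>

lemma log_size_le:
  assumes "q \<ge> 1" "real m \<le> real q ^ k * B"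
  shows "log_size q m \<le> ereal (real k + log (real q) B)"
proof (cases "q = 1 \<or> m = 0")
  case True
  then show ?thesis by (auto simp: log_size_def log_def)
next
  case False
  then have q: "real q > 1" using assms(1) by simp
  have "0 < real q ^ k * B" using False assms(2) by (simp add: less_le_trans)
  then have B: "B > 0" using q by (simp add: zero_less_mult_iff)
  have "log (real q) (real m) \<le> log (real q) (real q ^ k * B)"
    using q False assms(2) by simp
  also have "\<dots> = real k + log (real q) B"
    using q B by (simp add: log_mult log_nat_power)
  finally show ?thesis using False by (simp add: log_size_def)
qed

lemma max_code_size_linear_le:
  fixes lact :: "'r \<Rightarrow> 'a::{finite,ab_group_add} \<Rightarrow> 'a"
  assumes w: "mean_distance_bound w \<gamma>" and \<tau>: "0 \<le> \<tau>" "\<tau> \<le> \<sigma>" "\<gamma> * \<tau> < \<delta>"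
    and n: "n > 0" and d: "\<delta> * real n \<le> d"
  shows "real (max_code_size lact ract w n (nat \<lfloor>\<sigma> * real n\<rfloor>) l d)
    \<le> real (card (UNIV :: 'a set)) ^ (nat \<lfloor>\<sigma> * real n\<rfloor> - nat \<lfloor>\<tau> * real n\<rfloor>) * (\<delta> / (\<delta> - \<gamma> * \<tau>))"
    (is "_ \<le> ?q ^ (?s - ?t) * _")
proof -
  interpret mean_distance_bound w \<gamma> by fact
  have "real ?t \<le> \<tau> * real n" using \<tau> by simp
  then have "\<gamma> * real ?t \<le> \<gamma> * \<tau> * real n"
    using bound_nonneg by (simp add: mult.assoc mult_left_mono)
  moreover have "\<gamma> * \<tau> * real n < \<delta> * real n" using \<tau>(3) n by simp
  ultimately have gap: "0 < (\<delta> - \<gamma> * \<tau>) * real n"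
    "(\<delta> - \<gamma> * \<tau>) * real n \<le> \<delta> * real n - \<gamma> * real ?t"
    unfolding left_diff_distrib by linarith+
  have "\<delta> > 0" using \<tau> bound_nonneg by (smt (verit) mult_nonneg_nonneg)
  have "?t \<le> ?s" using \<tau>(2) by (intro nat_mono floor_mono mult_right_mono) simp_all
  then have "real (max_code_size lact ract w n ?s l d)
      \<le> ?q ^ (?s - ?t) * (\<delta> * real n / (\<delta> * real n - \<gamma> * real ?t))"
    using gap by (intro max_code_size_le[OF w d]) linarith+
  also have "\<dots> \<le> ?q ^ (?s - ?t) * (\<delta> * real n / ((\<delta> - \<gamma> * \<tau>) * real n))"
    using \<open>\<delta> > 0\<close> by (intro mult_left_mono frac_le[OF _ order_refl gap]) simp_all
  finally show ?thesis using n by simp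
qed

lemma alpha_le_diff:
  fixes lact :: "'r \<Rightarrow> 'a::{finite,ab_group_add} \<Rightarrow> 'a"
  assumes "mean_distance_bound w \<gamma>" and \<tau>: "0 \<le> \<tau>" "\<tau> \<le> \<sigma>" "\<gamma> * \<tau> < \<delta>"
  shows "alpha lact ract w \<sigma> lam \<delta> \<le> ereal (\<sigma> - \<tau>)"
proof -
  let ?q = "card (UNIV :: 'a set)"
  let ?size = "\<lambda>n. let s = nat \<lfloor>\<sigma> * real n\<rfloor>; l = nat \<lfloor>lam * real n\<rfloor>
    in max_code_size lact ract w n s l (distance_ceiling lact ract w n s l (\<delta> * real n))"
  define b where "b = 1 + log ?q (\<delta> / (\<delta> - \<gamma> * \<tau>))"
  have "ereal (1 / real n) * log_size ?q (?size n) \<le> ereal (\<sigma> - \<tau> + b / real n)" if n: "n > 0" for n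
  proof -
    let ?s = "nat \<lfloor>\<sigma> * real n\<rfloor>" and ?t = "nat \<lfloor>\<tau> * real n\<rfloor>"
    have "log_size ?q (?size n) \<le> ereal (real (?s - ?t) + log ?q (\<delta> / (\<delta> - \<gamma> * \<tau>)))"
      unfolding Let_def
      by (intro log_size_le max_code_size_linear_le[OF assms n] distance_ceiling_ge)
        (simp add: Suc_le_eq card_gt_0_iff)
    moreover have "\<tau> * real n \<le> \<sigma> * real n" using \<tau>(2) by (rule mult_right_mono) simp
    then have "real (?s - ?t) \<le> (\<sigma> - \<tau>) * real n + 1"
      using \<tau> by (simp add: left_diff_distrib) linarith
    ultimately have "log_size ?q (?size n) \<le> ereal ((\<sigma> - \<tau>) * real n + b)"
      unfolding b_def by (elim order_trans) simp
    then have "ereal (1 / real n) * log_size ?q (?size n)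
        \<le> ereal (1 / real n) * ereal ((\<sigma> - \<tau>) * real n + b)"
      by (rule ereal_mult_left_mono) simp
    also have "\<dots> = ereal (\<sigma> - \<tau> + b / real n)" using n by (simp add: field_simps)
    finally show ?thesis .
  qed
  then have "alpha lact ract w \<sigma> lam \<delta> \<le> limsup (\<lambda>n. ereal (\<sigma> - \<tau> + b / real n))"
    unfolding alpha_def Let_def
    by (intro Limsup_mono eventually_mono[OF eventually_gt_at_top[of 0]])
  also have "\<dots> = ereal (\<sigma> - \<tau>)"
  proof (rule lim_imp_Limsup)
    show "(\<lambda>n. ereal (\<sigma> - \<tau> + b / real n)) \<longlonglongrightarrow> ereal (\<sigma> - \<tau>)"
      using tendsto_add[OF tendsto_const lim_const_over_n, of "\<sigma> - \<tau>" b] by simp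
  qed simp
  finally show ?thesis .
qed

lemma alpha_plotkin_bound:
  fixes lact :: "'r \<Rightarrow> 'a::{finite,ab_group_add} \<Rightarrow> 'a"
  assumes w: "mean_distance_bound w \<gamma>" and pos: "0 < \<gamma>" "0 < \<delta>" and "\<delta> \<le> \<gamma> * \<sigma>"
  shows "alpha lact ract w \<sigma> lam \<delta> \<le> ereal (\<sigma> - \<delta> / \<gamma>)"
proof (rule ereal_le_epsilon2)
  fix e :: real assume "e > 0"
  let ?\<tau> = "max 0 (\<delta> / \<gamma> - e)"
  have "0 < \<delta> / \<gamma>" "\<delta> / \<gamma> \<le> \<sigma>" using assms by (simp_all add: pos_divide_le_eq mult.commute)
  then have "?\<tau> < \<delta> / \<gamma>" "?\<tau> \<le> \<sigma>" using \<open>e > 0\<close> by simp_all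
  then have "alpha lact ract w \<sigma> lam \<delta> \<le> ereal (\<sigma> - ?\<tau>)"
    using pos by (intro alpha_le_diff[OF w]) (simp_all add: pos_less_divide_eq mult.commute)
  also have "\<dots> \<le> ereal (\<sigma> - \<delta> / \<gamma>) + ereal e" by simp
  finally show "alpha lact ract w \<sigma> lam \<delta> \<le> ereal (\<sigma> - \<delta> / \<gamma>) + ereal e" .
qed

theorem mainTheorem10:
  fixes lact :: "'r::{finite,ring_1} \<Rightarrow> 'a::{finite,ab_group_add} \<Rightarrow> 'a"
    and ract :: "'a \<Rightarrow> 'r \<Rightarrow> 'a"
    and w :: "'a \<Rightarrow> real"
    and \<gamma> \<sigma> lam \<delta> :: real
  assumes "frobenius_bimodule lact ract"
    and "homogeneous_weight lact w \<gamma>"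
    and "\<gamma> > 0"
    and "0 < \<delta>"
    and "0 \<le> lam" and "lam < \<sigma>" and "\<sigma> \<le> 1"
  shows "alpha lact ract w \<sigma> lam \<delta> \<le> (if \<delta> > \<gamma> * \<sigma> then 0 else ereal (\<sigma> - \<delta> / \<gamma>))"
proof -
  have w: "mean_distance_bound w \<gamma>"
    by (rule frobenius_bimodule.mean_distance_bound_homogeneous_weight
        [OF assms(1,2) less_imp_le[OF assms(3)]])
  show ?thesis
  proof (cases "\<delta> > \<gamma> * \<sigma>")
    case True
    then show ?thesis using alpha_le_diff[OF w, of \<sigma> \<sigma>] assms(5,6) by (simp add: zero_ereal_def)
  next
    case False
    then have "\<delta> \<le> \<gamma> * \<sigma>" by simp
    from alpha_plotkin_bound[OF w assms(3,4) this] show ?thesis using False by simp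
  qed
qed

end
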